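(* Let $H$ be a Hilbert space and let $A\subseteq\mathcal{B}(H)$ be a C$^*$-algebra of real rank zero. Then, for any sequence $(P_n)_{n\in\omega}\subseteq\mathcal{P}(A)$, there exists a (possibly non-strictly) decreasing sequence $(Q_n)_{n\in\omega}\subseteq\mathcal{P}(A)$ such that $\bigwedge P_n=\bigwedge Q_n$. Moreover, if $\mathcal{P}(A)$ is $\sigma$-closed and $(P_n)$ has a greatest lower bound $Q$ in $\mathcal{P}(A)$ then $Q=P_0\wedge\ldots\wedge P_m$, for some $m\in\omega$.
   Context: Hilbert spaces and C$^*$-algebras are over $\mathbb{F}=\mathbb{R}$ or $\mathbb{C}$. $\mathcal{P}(A)$ is the set of projections (self-adjoint idempotents) of $A$, ordered by $P\leq Q\Leftrightarrow PQ=P$. $A$ has real rank zero if the invertible self-adjoint elements are dense in the self-adjoint elements of $A$ (of $A$ with a unit adjoined, if $A$ has none). For a set or sequence $\mathcal{P}$ of projections on $H$, $\bigwedge\mathcal{P}$ denotes its greatest lower bound in $\mathcal{P}(\mathcal{B}(H))$ (not in $\mathcal{P}(A)$), i.e. the projection onto the intersection of the ranges; $P_0\wedge\ldots\wedge P_m=\bigwedge\{P_0,\ldots,P_m\}$. A partially ordered set with minimum $0$ is $\sigma$-closed if every decreasing sequence of non-zero elements has a non-zero lower bound in it. *)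

theory Defs
  imports "HOL-Analysis.Analysis"
begin

text \<open>
  The scalar field is \<open>\<real>\<close> or \<open>\<complex>\<close>. A normed field over \<open>\<real>\<close> with an additive map \<open>fcnj\<close> such that
  \<open>fcnj x * x = \<bar>x\<bar>\<^sup>2\<close> is \<open>\<real>\<close> with \<open>fcnj = id\<close> or \<open>\<complex>\<close> with complex conjugation, up to isometric
  isomorphism; see \<open>real_or_complex_cases\<close> below.
\<close>

class real_or_complex = real_normed_field +
  fixes fcnj :: "'a \<Rightarrow> 'a"
  assumes fcnj_add: "fcnj (x + y) = fcnj x + fcnj y"
    and fcnj_mult_self_scaleR: "fcnj x * x = (norm x)\<^sup>2 *\<^sub>R 1"

instantiation real :: real_or_complex
begin
definition fcnj_real :: "real \<Rightarrow> real" where "fcnj_real x = x"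
instance by standard (simp_all add: fcnj_real_def power2_eq_square flip: of_real_def)
end

instantiation complex :: real_or_complex
begin
definition fcnj_complex :: "complex \<Rightarrow> complex" where "fcnj_complex = cnj"
instance
proof
  fix x y :: complex
  show "fcnj (x + y) = fcnj x + fcnj y" by (simp add: fcnj_complex_def)
  show "fcnj x * x = (norm x)\<^sup>2 *\<^sub>R 1"
    unfolding fcnj_complex_def of_real_def[symmetric] complex_norm_square by (rule mult.commute)
qed
end

lemma fcnj_mult_self: "fcnj x * x = of_real ((norm x)\<^sup>2)" for x :: "'k::real_or_complex"
  by (simp only: fcnj_mult_self_scaleR of_real_def)

lemma fcnj_zero [simp]: "fcnj (0::'k::real_or_complex) = 0"
  using fcnj_add[of "0::'k" 0] by simp

lemma fcnj_of_real [simp]: "fcnj (of_real r :: 'k::real_or_complex) = of_real r"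
proof (cases "r = 0")
  case False
  have "fcnj (of_real r :: 'k) * of_real r = of_real r * of_real r"
    using fcnj_mult_self[of "of_real r :: 'k"] by (simp add: power2_eq_square flip: of_real_mult)
  with False show ?thesis by simp
qed simp

lemma fcnj_mult: "fcnj (x * y :: 'k::real_or_complex) = fcnj x * fcnj y"
proof (cases "x * y = 0")
  case False
  have "fcnj (x * y) * (x * y) = (fcnj x * x) * (fcnj y * y)"
    by (simp add: fcnj_mult_self norm_mult power_mult_distrib)
  also have "\<dots> = (fcnj x * fcnj y) * (x * y)" by (simp only: ac_simps)
  finally show ?thesis using False by (metis mult_right_cancel)
qed auto

lemma add_fcnj_real: "x + fcnj x = of_real ((norm (x + 1))\<^sup>2 - (norm x)\<^sup>2 - 1)"
  for x :: "'k::real_or_complex"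
proof -
  have one: "fcnj (1::'k) = 1" using fcnj_of_real[of 1, where 'k = 'k] by simp
  have "x + fcnj x = fcnj (x + 1) * (x + 1) - fcnj x * x - 1"
    by (simp add: fcnj_add one distrib_left distrib_right)
  then show ?thesis by (simp only: fcnj_mult_self of_real_diff of_real_1)
qed

theorem real_or_complex_cases:
  obtains (real) "range (of_real :: real \<Rightarrow> 'k::real_or_complex) = UNIV"
  | (complex) f :: "complex \<Rightarrow> 'k::real_or_complex" where "bij f" "f 1 = 1"
      "\<And>w z. f (w + z) = f w + f z" "\<And>w z. f (w * z) = f w * f z"
      "\<And>r. f (of_real r) = of_real r"
      "\<And>z. norm (f z) = norm z" "\<And>z. f (cnj z) = fcnj (f z)"
proof (cases "range (of_real :: real \<Rightarrow> 'k) = UNIV")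
  case True
  then show thesis by (rule real)
next
  case False
  have sq: "\<exists>c d. (x - of_real c)\<^sup>2 = of_real d" for x :: 'k
  proof -
    obtain t where t: "x + fcnj x = of_real t" using add_fcnj_real by blast
    have "x * x - of_real t * x + of_real ((norm x)\<^sup>2) = 0"
      by (subst fcnj_mult_self[symmetric], subst t[symmetric]) (simp add: algebra_simps)
    moreover define u where "u = t / 2"
    moreover have "(of_real t :: 'k) = 2 * of_real u" by (simp add: u_def)
    ultimately have "x * x - 2 * of_real u * x + (of_real (norm x))\<^sup>2 = 0"
      by (simp only: of_real_power)
    then have "(x - of_real u)\<^sup>2 = (of_real u)\<^sup>2 - (of_real (norm x))\<^sup>2"
      by (simp add: power2_eq_square algebra_simps)
    also have "\<dots> = of_real (u\<^sup>2 - (norm x)\<^sup>2)" by simp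
    finally have "(x - of_real u)\<^sup>2 = of_real (u\<^sup>2 - (norm x)\<^sup>2)" .
    then show ?thesis by blast
  qed
  have no_sq: "y \<in> range of_real" if "y\<^sup>2 = of_real d" "d \<ge> 0" for y :: 'k and d
  proof -
    have "y\<^sup>2 = (of_real (sqrt d))\<^sup>2" using that by (simp flip: of_real_power)
    then have "y = of_real (sqrt d) \<or> y = - of_real (sqrt d)" by (simp only: power2_eq_iff)
    then show ?thesis by (metis of_real_minus rangeI)
  qed
  have dec: "\<exists>c d y. x = of_real c + of_real d * y \<and> y\<^sup>2 = -1" if x: "x \<notin> range of_real" for x :: 'k
  proof -
    obtain c d where cd: "(x - of_real c)\<^sup>2 = of_real d" using sq by blast
    have "d < 0"
    proof (rule ccontr)
      assume "\<not> d < 0"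
      with no_sq[OF cd] obtain r where "x - of_real c = of_real r" by auto
      then have "x = of_real (r + c)" by (simp add: algebra_simps)
      with x show False by blast
    qed
    define s where "s = sqrt (- d)"
    have s: "s \<noteq> 0" "s\<^sup>2 = - d" using \<open>d < 0\<close> by (auto simp: s_def)
    let ?y = "(x - of_real c) / of_real s"
    have "?y\<^sup>2 = of_real d / of_real (s\<^sup>2)" by (simp add: power_divide cd)
    also have "\<dots> = -1" using \<open>d < 0\<close> by (simp add: s)
    finally have "?y\<^sup>2 = -1" .
    moreover have "x = of_real c + of_real s * ?y" using s by simp
    ultimately show ?thesis by blast
  qed
  obtain i :: 'k where i: "i\<^sup>2 = -1" using False dec by blast
  have ii: "i * i = -1" using i by (simp add: power2_eq_square)
  have i0: "i \<noteq> 0" using i by auto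
  have ni: "norm i = 1"
  proof -
    have "(norm i)\<^sup>2 = 1" using arg_cong[OF i, of norm] by (simp add: norm_power)
    then show ?thesis using norm_ge_zero[of i] unfolding power2_eq_1_iff by linarith
  qed
  have ci: "fcnj i = - i"
  proof -
    have "fcnj i * i = (- i) * i" using fcnj_mult_self[of i] ni ii by simp
    then show ?thesis using i0 by (simp only: mult_cancel_right) simp
  qed
  define f where "f z = of_real (Re z) + of_real (Im z) * i" for z
  have add: "f (w + z) = f w + f z" for w z by (simp add: f_def algebra_simps)
  have mult: "f (w * z) = f w * f z" for w z
  proof -
    have "f w * f z = of_real (Re w * Re z) + of_real (Im w * Im z) * (i * i)
        + of_real (Re w * Im z + Im w * Re z) * i"
      by (simp add: f_def algebra_simps)
    then show ?thesis by (simp add: f_def ii)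
  qed
  have cn: "f (cnj z) = fcnj (f z)" for z
    by (simp add: f_def fcnj_add fcnj_mult ci)
  have nrm: "norm (f z) = norm z" for z
  proof -
    have "(of_real ((norm (f z))\<^sup>2) :: 'k) = f (cnj z * z)"
      by (simp only: fcnj_mult_self[symmetric] mult cn)
    also have "cnj z * z = of_real ((norm z)\<^sup>2)"
      by (simp only: complex_norm_square mult.commute)
    also have "f (of_real ((norm z)\<^sup>2)) = of_real ((norm z)\<^sup>2)" by (simp add: f_def flip: of_real_power)
    finally have "(norm (f z))\<^sup>2 = (norm z)\<^sup>2" by (simp only: of_real_eq_iff)
    then show ?thesis by simp
  qed
  have "inj f"
  proof (rule injI)
    fix w z assume "f w = f z"
    then have "f (w - z) = 0" using add[of "w - z" z] by simp
    then show "w = z" using nrm[of "w - z"] by simp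
  qed
  moreover have "x \<in> range f" for x
  proof (cases "x \<in> range of_real")
    case True
    then obtain r where "x = of_real r" by blast
    then have "x = f (of_real r)" by (simp add: f_def)
    then show ?thesis by blast
  next
    case False
    then obtain c d y where y: "x = of_real c + of_real d * y" "y\<^sup>2 = -1" using dec by blast
    then have "y\<^sup>2 = i\<^sup>2" by (simp only: i)
    then have "y = i \<or> y = - i" by (simp only: power2_eq_iff)
    then have "x = f (Complex c d) \<or> x = f (Complex c (- d))"
      by (elim disjE) (simp_all add: f_def y(1))
    then show ?thesis by blast
  qed
  ultimately have "bij f" unfolding bij_def by blast
  have f1: "f 1 = 1" by (simp add: f_def)
  have fr: "f (of_real r) = of_real r" for r by (simp add: f_def)
  show thesis by (rule complex[OF \<open>bij f\<close> f1 add mult fr nrm cn])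
qed

text \<open>A unit of \<open>A\<close> need not be the identity operator on the whole space.\<close>

definition is_unit_of :: "('v::real_normed_vector \<Rightarrow>\<^sub>L 'v) set \<Rightarrow> ('v \<Rightarrow>\<^sub>L 'v) \<Rightarrow> bool" where
  "is_unit_of A e \<longleftrightarrow> e \<in> A \<and> (\<forall>T\<in>A. e o\<^sub>L T = T \<and> T o\<^sub>L e = T)"

definition invertible_in :: "('v::real_normed_vector \<Rightarrow>\<^sub>L 'v) set \<Rightarrow> ('v \<Rightarrow>\<^sub>L 'v) \<Rightarrow> bool" where
  "invertible_in A T \<longleftrightarrow> T \<in> A \<and> (\<exists>S\<in>A. \<exists>e. is_unit_of A e \<and> S o\<^sub>L T = e \<and> T o\<^sub>L S = e)"

definition proj_le :: "('v::real_normed_vector \<Rightarrow>\<^sub>L 'v) \<Rightarrow> ('v \<Rightarrow>\<^sub>L 'v) \<Rightarrow> bool" where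
  "proj_le P Q \<longleftrightarrow> P o\<^sub>L Q = P"

definition proj_decreasing :: "(nat \<Rightarrow> ('v::real_normed_vector \<Rightarrow>\<^sub>L 'v)) \<Rightarrow> bool" where
  "proj_decreasing P \<longleftrightarrow> (\<forall>m n. m \<le> n \<longrightarrow> proj_le (P n) (P m))"

definition is_glb_in ::
    "('v::real_normed_vector \<Rightarrow>\<^sub>L 'v) set \<Rightarrow> ('v \<Rightarrow>\<^sub>L 'v) set \<Rightarrow> ('v \<Rightarrow>\<^sub>L 'v) \<Rightarrow> bool" where
  "is_glb_in X \<P> Q \<longleftrightarrow>
    Q \<in> X \<and> (\<forall>P\<in>\<P>. proj_le Q P) \<and> (\<forall>R\<in>X. (\<forall>P\<in>\<P>. proj_le R P) \<longrightarrow> proj_le R Q)"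

definition sigma_closed :: "('v::real_normed_vector \<Rightarrow>\<^sub>L 'v) set \<Rightarrow> bool" where
  "sigma_closed X \<longleftrightarrow>
    (\<forall>R. (\<forall>n. R n \<in> X - {0}) \<and> proj_decreasing R \<longrightarrow> (\<exists>S\<in>X - {0}. \<forall>n. proj_le S (R n)))"

text \<open>
  The topology, the norm and completeness come from the type class \<open>banach\<close> (whose scalars are real);
  the last two assumptions tie the norm and the real scalar multiplication of that class to the
  scalar multiplication and the inner product over \<open>'k\<close>. The inner product is linear in its
  first argument.
\<close>

locale hilbert_space = vector_space scale
  for scale :: "'k::real_or_complex \<Rightarrow> 'h::banach \<Rightarrow> 'h" +
  fixes ip :: "'h \<Rightarrow> 'h \<Rightarrow> 'k"
  assumes ip_add_left: "ip (x + y) z = ip x z + ip y z"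
    and ip_scale_left: "ip (scale c x) y = c * ip x y"
    and ip_commute: "ip y x = fcnj (ip x y)"
    and ip_self: "ip x x = of_real ((norm x)\<^sup>2)"
    and scale_of_real: "scale (of_real r) x = r *\<^sub>R x"
begin

lemma norm_scale: "norm (scale c x) = norm c * norm x"
proof -
  have "of_real ((norm (scale c x))\<^sup>2) = c * (fcnj c * ip x x)"
    by (metis fcnj_mult ip_commute ip_scale_left ip_self)
  also have "\<dots> = (of_real ((norm c * norm x)\<^sup>2) :: 'k)"
    using fcnj_mult_self[of c] by (simp add: ip_self power_mult_distrib mult.commute mult.left_commute)
  finally have "(norm (scale c x))\<^sup>2 = (norm c * norm x)\<^sup>2" by (simp only: of_real_eq_iff)
  then show ?thesis by simp
qed

lemma bounded_linear_scale: "bounded_linear (scale c)"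
proof (rule bounded_linear_intro)
  show "scale c (r *\<^sub>R x) = r *\<^sub>R scale c x" for r x
    by (metis scale_of_real scale_left_commute)
  show "norm (scale c x) \<le> norm x * norm c" for x by (simp add: norm_scale)
qed (rule scale_right_distrib)

text \<open>\<open>'h \<Rightarrow>\<^sub>L 'h\<close> consists of the bounded real-linear operators, with the operator norm.\<close>

definition bounded_ops :: "('h \<Rightarrow>\<^sub>L 'h) set" where
  "bounded_ops = {T :: 'h \<Rightarrow>\<^sub>L 'h. \<forall>c x. T (scale c x) = scale c (T x)}"

definition scale_op :: "'k \<Rightarrow> ('h \<Rightarrow>\<^sub>L 'h) \<Rightarrow> ('h \<Rightarrow>\<^sub>L 'h)" where
  "scale_op c T = Blinfun (\<lambda>x. scale c (T x))"

lemma scale_op_apply [simp]: "scale_op c T x = scale c (T x)"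
  unfolding scale_op_def
  by (simp add: bounded_linear_Blinfun_apply bounded_linear_compose[OF bounded_linear_scale]
      blinfun.bounded_linear_right)

definition is_adjoint :: "('h \<Rightarrow>\<^sub>L 'h) \<Rightarrow> ('h \<Rightarrow>\<^sub>L 'h) \<Rightarrow> bool" where
  "is_adjoint T S \<longleftrightarrow> (\<forall>x y. ip (T x) y = ip x (S y))"

definition selfadjoint :: "('h \<Rightarrow>\<^sub>L 'h) \<Rightarrow> bool" where
  "selfadjoint T \<longleftrightarrow> is_adjoint T T"

definition cstar_subalgebra :: "('h \<Rightarrow>\<^sub>L 'h) set \<Rightarrow> bool" where
  "cstar_subalgebra A \<longleftrightarrow>
    A \<subseteq> bounded_ops \<and> closed A \<and> 0 \<in> A \<and>
    (\<forall>S\<in>A. \<forall>T\<in>A. S + T \<in> A) \<and>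
    (\<forall>c. \<forall>T\<in>A. scale_op c T \<in> A) \<and>
    (\<forall>S\<in>A. \<forall>T\<in>A. S o\<^sub>L T \<in> A) \<and>
    (\<forall>T\<in>A. \<exists>S\<in>A. is_adjoint T S)"

text \<open>
  If \<open>A\<close> has no unit, then the identity operator is not in \<open>A\<close>, the operators \<open>T + c 1\<close> form
  a C*-algebra isomorphic to the unitization \<open>A \<oplus> 'k\<close>, and the operator norm is its (unique) C*-norm.
\<close>

definition unitization :: "('h \<Rightarrow>\<^sub>L 'h) set \<Rightarrow> ('h \<Rightarrow>\<^sub>L 'h) set" where
  "unitization A =
    (if \<exists>e. is_unit_of A e then A else {T + scale_op c id_blinfun |T c. T \<in> A})"

definition real_rank_zero :: "('h \<Rightarrow>\<^sub>L 'h) set \<Rightarrow> bool" where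
  "real_rank_zero A \<longleftrightarrow>
    {T \<in> unitization A. selfadjoint T} \<subseteq>
      closure {T \<in> unitization A. selfadjoint T \<and> invertible_in (unitization A) T}"

definition projections :: "('h \<Rightarrow>\<^sub>L 'h) set \<Rightarrow> ('h \<Rightarrow>\<^sub>L 'h) set" where
  "projections A = {P \<in> A. selfadjoint P \<and> P o\<^sub>L P = P}"

text \<open>
  For a set of projections the greatest lower bound among all projections on \<open>'h\<close> exists and is unique:
  it is the projection onto the intersection of the ranges.
\<close>

definition meet :: "('h \<Rightarrow>\<^sub>L 'h) set \<Rightarrow> ('h \<Rightarrow>\<^sub>L 'h)" where
  "meet \<P> = (THE Q. is_glb_in (projections bounded_ops) \<P> Q)"

end

end

theory Submission
  imports Defs
begin

text \<open>
  Start with \<open>Q\<^sub>0 = P\<^sub>0\<close>. Given \<open>Q\<^sub>n\<close>, put \<open>D = \<Sum>i\<le>n. Q\<^sub>n (1 - P\<^sub>i) Q\<^sub>n \<in> A\<close>, a positive operator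
  that vanishes on the common range of \<open>P\<^sub>0, \<dots>, P\<^sub>n, Q\<^sub>n\<close>. Real rank zero gives an invertible
  self-adjoint \<open>X\<close> close to \<open>D - \<delta>\<close>; let \<open>E\<close> be its positive spectral projection. Then \<open>D\<close> is bounded
  below on the range of \<open>E\<close>, so the projection \<open>N\<close> onto the range of \<open>D E\<close> lies in \<open>A\<close>; and \<open>D\<close> is small on
  the kernel of \<open>E\<close>, hence also on the kernel of \<open>N\<close>, because \<open>E D = 0\<close> there. So \<open>Q\<^sub>n\<^sub>+\<^sub>1 = Q\<^sub>n - N\<close>
  dominates \<open>P\<^sub>0 \<and> \<dots> \<and> P\<^sub>n\<close>, and its vectors are almost fixed by \<open>P\<^sub>0, \<dots>, P\<^sub>n\<close>.

  For the second part apply this to the projections \<open>P\<^sub>i - Q\<close>, whose greatest lower bound in \<open>A\<close>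
  is \<open>0\<close>: by \<open>\<sigma>\<close>-closedness some term of the decreasing sequence is \<open>0\<close>, and it dominates a finite meet.
\<close>

text \<open>In a Hilbert space this is the real part of the inner product, by polarization.\<close>

definition re_ip :: "'v::real_normed_vector \<Rightarrow> 'v \<Rightarrow> real" where
  "re_ip x y = ((norm (x + y))\<^sup>2 - (norm (x - y))\<^sup>2) / 4"

definition re_symmetric :: "('v::real_normed_vector \<Rightarrow>\<^sub>L 'v) \<Rightarrow> bool" where
  "re_symmetric T \<longleftrightarrow> (\<forall>x y. re_ip (T x) y = re_ip x (T y))"

text \<open>
  For a C*-algebra \<open>A\<close> of operators this is a closed unital algebra in which \<open>A\<close> is a left ideal, so that
  \<open>D W D \<in> A\<close> for \<open>D \<in> A\<close> and a multiplier \<open>W\<close>. Unlike \<open>A + 'k 1\<close>, it is closed for trivial reasons.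
\<close>

definition left_multipliers :: "('v::real_normed_vector \<Rightarrow>\<^sub>L 'v) set \<Rightarrow> ('v \<Rightarrow>\<^sub>L 'v) set" where
  "left_multipliers A = {T. \<forall>S\<in>A. T o\<^sub>L S \<in> A}"

section \<open>The polarized real inner product\<close>

lemma re_ip_commute: "re_ip x y = re_ip y x"
  by (simp add: re_ip_def add.commute norm_minus_commute)

lemma re_ip_self: "re_ip x x = (norm x)\<^sup>2"
proof -
  have "norm (x + x) = 2 * norm x" by (metis norm_scaleR scaleR_2 abs_numeral)
  then show ?thesis by (simp add: re_ip_def power_mult_distrib)
qed

text \<open>Cauchy-Schwarz from triangle inequalities: the two squares in \<open>re_ip\<close>
  differ by at most (|x| + |y|)^2 - (|x| - |y|)^2 = 4 |x| |y|.\<close>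

lemma re_ip_le: "re_ip x y \<le> norm x * norm y"
proof -
  have "(norm (x + y))\<^sup>2 \<le> (norm x + norm y)\<^sup>2"
    by (intro power_mono norm_triangle_ineq) simp
  moreover have "(norm x - norm y)\<^sup>2 \<le> (norm (x - y))\<^sup>2"
    using power_mono[OF norm_triangle_ineq3[of x y], of 2] by simp
  ultimately show ?thesis by (simp add: re_ip_def power2_eq_square algebra_simps)
qed

lemma re_symmetricD: "re_symmetric T \<Longrightarrow> re_ip (T x) y = re_ip x (T y)"
  by (simp add: re_symmetric_def)

lemma closed_re_symmetric: "closed {T :: 'v::real_normed_vector \<Rightarrow>\<^sub>L 'v. re_symmetric T}"
proof -
  have "{T. re_symmetric T} = (\<Inter>x. \<Inter>y. {T :: 'v \<Rightarrow>\<^sub>L 'v. re_ip (T x) y = re_ip x (T y)})"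
    by (auto simp: re_symmetric_def)
  moreover have "closed {T :: 'v \<Rightarrow>\<^sub>L 'v. re_ip (T x) y = re_ip x (T y)}" for x y :: 'v
    unfolding re_ip_def by (intro closed_Collect_eq continuous_intros) simp_all
  ultimately show ?thesis by (simp add: closed_INT)
qed

context hilbert_space
begin

section \<open>Comparing the scalar-valued and the real inner product\<close>

lemma ip_add_right: "ip x (y + z) = ip x y + ip x z"
  by (metis fcnj_add ip_add_left ip_commute)

lemma ip_diff_left: "ip (x - y) z = ip x z - ip y z"
  by (metis add_diff_cancel diff_add_cancel ip_add_left)

lemma fcnj_diff: "fcnj (a - b :: 'k) = fcnj a - fcnj b"
  by (metis add_diff_cancel diff_add_cancel fcnj_add)

lemma ip_diff_right: "ip x (y - z) = ip x y - ip x z"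
  by (metis add_diff_cancel diff_add_cancel ip_add_right)

text \<open>Polarization. As \<open>of_real\<close> is injective, identities for \<open>ip\<close>
  can be pulled back to \<open>re_ip\<close> through this equation.\<close>

lemma of_real_re_ip: "of_real (2 * re_ip x y) = ip x y + ip y x"
proof -
  have "of_real (4 * re_ip x y) = ip (x + y) (x + y) - ip (x - y) (x - y)"
    by (simp add: re_ip_def ip_self)
  also have "\<dots> = 2 * (ip x y + ip y x)"
    by (simp add: ip_add_left ip_add_right ip_diff_left ip_diff_right algebra_simps)
  finally have "2 * of_real (2 * re_ip x y) = 2 * (ip x y + ip y x)"
    using of_real_mult[of 2 "2 * re_ip x y", where 'a = 'k] by (simp del: of_real_mult)
  then show ?thesis by (simp only: mult_cancel_left) simp
qed

lemma bounded_bilinear_re_ip: "bounded_bilinear (re_ip :: 'h \<Rightarrow> 'h \<Rightarrow> real)"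
proof -
  have add: "re_ip (x + y) z = re_ip x z + re_ip y z" for x y z :: 'h
  proof -
    have "(of_real (2 * re_ip (x + y) z) :: 'k) = of_real (2 * (re_ip x z + re_ip y z))"
      by (simp only: distrib_left of_real_add of_real_re_ip) (simp add: ip_add_left ip_add_right)
    then show ?thesis by (simp only: of_real_eq_iff) simp
  qed
  have sc: "re_ip (r *\<^sub>R x) y = r *\<^sub>R re_ip x y" for r and x y :: 'h
  proof -
    have "ip (r *\<^sub>R x) y = of_real r * ip x y"
      by (metis ip_scale_left scale_of_real)
    moreover from this have "ip y (r *\<^sub>R x) = of_real r * ip y x"
      by (metis fcnj_mult fcnj_of_real ip_commute)
    ultimately have "of_real (2 * re_ip (r *\<^sub>R x) y) = of_real r * (ip x y + ip y x)"
      by (simp only: of_real_re_ip distrib_left)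
    also have "\<dots> = (of_real (2 * (r * re_ip x y)) :: 'k)"
      by (simp only: of_real_re_ip[symmetric] of_real_mult mult.left_commute)
    finally show ?thesis by (simp only: of_real_eq_iff) simp
  qed
  \<comment> \<open>Cauchy-Schwarz was proved one-sided; applying it to -x gives the other
    bound.\<close>
  have "\<bar>re_ip x y\<bar> \<le> norm x * norm y" for x y :: 'h
    using re_ip_le[of x y] re_ip_le[of "-1 *\<^sub>R x" y] sc[of "-1" x y] by simp
  then have bd: "\<exists>K. \<forall>x y :: 'h. norm (re_ip x y) \<le> norm x * norm y * K"
    by (intro exI[of _ 1]) simp
  have "re_ip x (y + z) = re_ip x y + re_ip x z" "re_ip x (r *\<^sub>R y) = r *\<^sub>R re_ip x y"
    for r and x y z :: 'h
    by (simp_all only: re_ip_commute[of x] add sc)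
  then show ?thesis by (intro bounded_bilinear.intro add sc bd)
qed

sublocale re_ip: bounded_bilinear "re_ip :: 'h \<Rightarrow> 'h \<Rightarrow> real"
  by (rule bounded_bilinear_re_ip)

lemma norm_diff_sq: "(norm (x - y))\<^sup>2 = (norm x)\<^sup>2 - 2 * re_ip x y + (norm y)\<^sup>2" for x y :: 'h
  by (simp add: re_ip.diff_left re_ip.diff_right re_ip_commute[of y x] flip: re_ip_self)

lemma selfadjoint_imp_re_symmetric:
  assumes "selfadjoint T" shows "re_symmetric T"
  unfolding re_symmetric_def
proof (intro allI)
  fix x y
  have T: "ip (T u) v = ip u (T v)" for u v
    using assms by (simp add: selfadjoint_def is_adjoint_def)
  have "(of_real (2 * re_ip (T x) y) :: 'k) = of_real (2 * re_ip x (T y))"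
    unfolding of_real_re_ip by (simp add: T)
  then show "re_ip (T x) y = re_ip x (T y)" unfolding of_real_eq_iff by simp
qed

text \<open>Let z be the defect \<open>ip (T x) y - ip x (T y)\<close>. Since T is linear over the
  scalars, replacing x by \<open>scale (fcnj z) x\<close> turns the defect into |z|^2, and real
  symmetry at that vector forces |z|^2 = -|z|^2.\<close>

lemma re_symmetric_imp_selfadjoint:
  assumes "T \<in> bounded_ops" "re_symmetric T" shows "selfadjoint T"
  unfolding selfadjoint_def is_adjoint_def
proof (intro allI)
  fix x y
  define z where "z = ip (T x) y - ip x (T y)"
  have "(of_real (2 * re_ip (T (scale (fcnj z) x)) y) :: 'k)
      = of_real (2 * re_ip (scale (fcnj z) x) (T y))"
    by (simp add: re_symmetricD[OF assms(2)])
  then have "ip (T (scale (fcnj z) x)) y - ip (scale (fcnj z) x) (T y)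
      = ip (T y) (scale (fcnj z) x) - ip y (T (scale (fcnj z) x))"
    unfolding of_real_re_ip by (simp add: algebra_simps)
  moreover have "ip (T (scale (fcnj z) x)) y - ip (scale (fcnj z) x) (T y) = of_real ((norm z)\<^sup>2)"
    using assms(1) fcnj_mult_self[of z]
    by (simp add: bounded_ops_def ip_scale_left z_def right_diff_distrib)
  moreover from this have "ip (T y) (scale (fcnj z) x) - ip y (T (scale (fcnj z) x))
      = - of_real ((norm z)\<^sup>2)"
    by (metis fcnj_diff fcnj_of_real ip_commute minus_diff_eq)
  ultimately have "(of_real ((norm z)\<^sup>2) :: 'k) = of_real (- ((norm z)\<^sup>2))" by simp
  then have "z = 0" by (simp only: of_real_eq_iff) simp
  then show "ip (T x) y = ip x (T y)" by (simp add: z_def)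
qed

section \<open>The algebra and its left multipliers\<close>

lemma cstar_subalgebra_scaleR:
  assumes "cstar_subalgebra A" "T \<in> A" shows "r *\<^sub>R T \<in> A"
proof -
  have "r *\<^sub>R T = scale_op (of_real r) T"
    by (rule blinfun_eqI) (simp add: scale_of_real blinfun.scaleR_left)
  with assms show ?thesis by (simp add: cstar_subalgebra_def)
qed

lemma cstar_subalgebraD:
  assumes "cstar_subalgebra A"
  shows "A \<subseteq> bounded_ops" "closed A" "0 \<in> A"
    "\<And>S T. S \<in> A \<Longrightarrow> T \<in> A \<Longrightarrow> S + T \<in> A"
    "\<And>S T. S \<in> A \<Longrightarrow> T \<in> A \<Longrightarrow> S - T \<in> A"
    "\<And>c T. T \<in> A \<Longrightarrow> scale_op c T \<in> A"
    "\<And>S T. S \<in> A \<Longrightarrow> T \<in> A \<Longrightarrow> S o\<^sub>L T \<in> A"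
proof -
  show "S - T \<in> A" if "S \<in> A" "T \<in> A" for S T
    using cstar_subalgebra_scaleR[OF assms that(2), of "-1"] assms that
    unfolding cstar_subalgebra_def by (metis diff_conv_add_uminus scaleR_minus1_left)
qed (use assms in \<open>auto simp: cstar_subalgebra_def\<close>)

lemma closed_left_multipliers:
  assumes "closed A" shows "closed (left_multipliers A)"
proof -
  have "left_multipliers A = (\<Inter>S\<in>A. (\<lambda>T. T o\<^sub>L S) -` A)"
    by (auto simp: left_multipliers_def)
  moreover have "closed ((\<lambda>T. T o\<^sub>L S) -` A)" for S
    using assms by (intro closed_vimage continuous_intros)
  ultimately show ?thesis by auto
qed

lemma left_multipliersI:
  assumes "cstar_subalgebra A"
  shows "T \<in> A \<Longrightarrow> T \<in> left_multipliers A"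
    and "id_blinfun \<in> left_multipliers A"
    and "S \<in> left_multipliers A \<Longrightarrow> T \<in> left_multipliers A \<Longrightarrow> S + T \<in> left_multipliers A"
    and "S \<in> left_multipliers A \<Longrightarrow> T \<in> left_multipliers A \<Longrightarrow> S - T \<in> left_multipliers A"
    and "S \<in> left_multipliers A \<Longrightarrow> T \<in> left_multipliers A \<Longrightarrow> S o\<^sub>L T \<in> left_multipliers A"
    and "T \<in> left_multipliers A \<Longrightarrow> r *\<^sub>R T \<in> left_multipliers A"
    and "T \<in> left_multipliers A \<Longrightarrow> scale_op c T \<in> left_multipliers A"
proof -
  have assoc: "(S o\<^sub>L T) o\<^sub>L U = S o\<^sub>L (T o\<^sub>L U)" for S T U :: "'h \<Rightarrow>\<^sub>L 'h"
    by (rule blinfun_eqI) simp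
  have id: "id_blinfun o\<^sub>L U = U" for U :: "'h \<Rightarrow>\<^sub>L 'h"
    by (rule blinfun_eqI) simp
  have sc: "scale_op c T o\<^sub>L U = scale_op c (T o\<^sub>L U)" for c and T U :: "'h \<Rightarrow>\<^sub>L 'h"
    by (rule blinfun_eqI) simp
  note [simp] = left_multipliers_def bounded_bilinear.add_left[OF bounded_bilinear_blinfun_compose]
    bounded_bilinear.diff_left[OF bounded_bilinear_blinfun_compose]
    bounded_bilinear.scaleR_left[OF bounded_bilinear_blinfun_compose] assoc id sc cstar_subalgebra_scaleR[OF assms]
    cstar_subalgebraD[OF assms]
  show "T \<in> A \<Longrightarrow> T \<in> left_multipliers A" "id_blinfun \<in> left_multipliers A"
    "S \<in> left_multipliers A \<Longrightarrow> T \<in> left_multipliers A \<Longrightarrow> S + T \<in> left_multipliers A"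
    "S \<in> left_multipliers A \<Longrightarrow> T \<in> left_multipliers A \<Longrightarrow> S - T \<in> left_multipliers A"
    "S \<in> left_multipliers A \<Longrightarrow> T \<in> left_multipliers A \<Longrightarrow> S o\<^sub>L T \<in> left_multipliers A"
    "T \<in> left_multipliers A \<Longrightarrow> r *\<^sub>R T \<in> left_multipliers A"
    "T \<in> left_multipliers A \<Longrightarrow> scale_op c T \<in> left_multipliers A"
    by auto
qed

section \<open>Inverses, square roots and spectral projections of multipliers\<close>

text \<open>For small t the operator M = 1 - t C has norm below 1, so V \<mapsto> V M + t is a
  contraction, and its fixed point satisfies V C = 1. Solving for the operator V instead of for
  vectors keeps the inverse among the left multipliers.\<close>

lemma coercive_inverse:
  assumes "cstar_subalgebra A" "C \<in> left_multipliers A" "0 < g"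
    and coercive: "\<And>x. g * (norm x)\<^sup>2 \<le> re_ip (C x) x"
  obtains V where "V \<in> left_multipliers A" "\<And>x. V (C x) = x" "\<And>x. C (V x) = x"
proof -
  define L where "L = norm C + g"
  \<comment> \<open>This t minimizes 1 - 2 t g + t^2 L^2, with minimum 1 - g^2 / L^2. The summand g
    in L ensures g \<le> L, so that \<open>q\<close> is the root of a nonnegative number.\<close>
  define t where "t = g / L\<^sup>2"
  define M where "M = id_blinfun - t *\<^sub>R C"
  define q where "q = sqrt (1 - g\<^sup>2 / L\<^sup>2)"
  have L: "0 < L" "g \<le> L" using \<open>0 < g\<close> by (simp_all add: L_def add_nonneg_pos)
  have t: "0 < t" using L \<open>0 < g\<close> by (simp add: t_def)
  have g2: "0 < g\<^sup>2 / L\<^sup>2" "g\<^sup>2 / L\<^sup>2 \<le> 1"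
    using L \<open>0 < g\<close> by (simp_all add: power_mono)
  then have q: "0 \<le> q" "q < 1" by (simp_all add: q_def)
  have Mx: "M x = x - t *\<^sub>R C x" for x
    by (simp add: M_def blinfun.diff_left blinfun.scaleR_left)
  have "norm M \<le> q"
  proof (rule norm_blinfun_bound)
    fix x
    have "norm (C x) \<le> L * norm x"
      using norm_blinfun[of C x] mult_right_mono[of "norm C" L "norm x"] \<open>0 < g\<close> by (simp add: L_def)
    then have Cx: "(norm (C x))\<^sup>2 \<le> L\<^sup>2 * (norm x)\<^sup>2"
      by (metis norm_ge_zero power_mono power_mult_distrib)
    have "(norm (M x))\<^sup>2 = (norm x)\<^sup>2 - 2 * t * re_ip (C x) x + t\<^sup>2 * (norm (C x))\<^sup>2"
      by (simp add: Mx norm_diff_sq re_ip.scaleR_right re_ip_commute[of x] power_mult_distrib)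
    also have "\<dots> \<le> (norm x)\<^sup>2 - 2 * t * (g * (norm x)\<^sup>2) + t\<^sup>2 * (L\<^sup>2 * (norm x)\<^sup>2)"
      using coercive[of x] Cx t by (intro add_mono diff_mono mult_left_mono) auto
    also have "\<dots> = (1 - g\<^sup>2 / L\<^sup>2) * (norm x)\<^sup>2"
      using L by (simp add: t_def field_simps power2_eq_square)
    also have "\<dots> = (q * norm x)\<^sup>2" using g2 by (simp add: q_def power_mult_distrib)
    finally show "norm (M x) \<le> q * norm x"
      by (rule power2_le_imp_le) (use q in simp)
  qed (use q in simp)
  \<comment> \<open>Commutation with C is a closed condition preserved by the iteration; it makes
    the left inverse a right inverse as well.\<close>
  let ?S = "{V \<in> left_multipliers A. V o\<^sub>L C = C o\<^sub>L V}"
  let ?f = "\<lambda>V. (V o\<^sub>L M) + t *\<^sub>R id_blinfun"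
  have "\<exists>!V\<in>?S. ?f V = V"
  proof (rule Banach_fix)
    have "closed (left_multipliers A \<inter> {V. V o\<^sub>L C = C o\<^sub>L V})"
      using assms by (intro closed_Int closed_left_multipliers cstar_subalgebraD closed_Collect_eq
          continuous_intros)
    then show "complete ?S" by (simp add: complete_eq_closed Collect_conj_eq)
    have "id_blinfun \<in> ?S" by (auto simp: left_multipliersI[OF assms(1)] intro: blinfun_eqI)
    then show "?S \<noteq> {}" by blast
    show "?f ` ?S \<subseteq> ?S"
    proof safe
      fix V assume V: "V \<in> left_multipliers A" and c: "V o\<^sub>L C = C o\<^sub>L V"
      show "?f V \<in> left_multipliers A"
        unfolding M_def by (intro left_multipliersI V assms)
      have "V (C x) = C (V x)" for x using c by (metis blinfun_apply_blinfun_compose)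
      then show "?f V o\<^sub>L C = C o\<^sub>L ?f V"
        by (intro blinfun_eqI) (simp add: Mx blinfun.bilinear_simps)
    qed
    show "dist (?f V) (?f W) \<le> q * dist V W" if "V \<in> ?S" "W \<in> ?S" for V W
    proof -
      have "dist (?f V) (?f W) = norm ((V - W) o\<^sub>L M)"
        by (simp add: dist_norm bounded_bilinear.diff_left[OF bounded_bilinear_blinfun_compose])
      also have "\<dots> \<le> norm (V - W) * norm M" by (rule norm_blinfun_compose)
      also have "\<dots> \<le> norm (V - W) * q" using \<open>norm M \<le> q\<close> by (intro mult_left_mono) auto
      finally show ?thesis by (simp add: dist_norm mult.commute)
    qed
  qed (use q in auto)
  then obtain V where V: "V \<in> left_multipliers A" "V o\<^sub>L C = C o\<^sub>L V" "?f V = V" by blast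
  have "V (C x) = x" for x
  proof -
    have "V (M x) + t *\<^sub>R x = V x"
      using arg_cong[OF V(3), of "\<lambda>T. blinfun_apply T x"] by (simp add: blinfun.bilinear_simps)
    then have "t *\<^sub>R x = t *\<^sub>R V (C x)" by (simp add: Mx blinfun.bilinear_simps)
    then show ?thesis using t by (metis less_irrefl scaleR_left_imp_eq)
  qed
  moreover have "C (V x) = V (C x)" for x using V(2) by (metis blinfun_apply_blinfun_compose)
  ultimately show thesis using V(1) that by simp
qed

text \<open>
  Writing \<open>X\<^sup>2 = 1 - E\<close> and \<open>K = 1 - F\<close>, the equation \<open>K\<^sup>2 = X\<^sup>2\<close> becomes the fixed point equation
  \<open>F = (E + F\<^sup>2) / 2\<close>, which is contractive on the ball of radius \<open>\<parallel>E\<parallel> < 1\<close>.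
\<close>

lemma square_root_of_square:
  assumes A: "cstar_subalgebra A" and X: "X \<in> left_multipliers A" "re_symmetric X" "norm X \<le> 1"
    and "0 < c" and below: "\<And>x. c * norm x \<le> norm (X x)"
  obtains K where "K \<in> left_multipliers A" "re_symmetric K" "\<And>x. K (X x) = X (K x)"
    "\<And>x. K (K x) = X (X x)" "\<And>x. 0 \<le> re_ip (K x) x"
proof -
  define b where "b = min c 1"
  define e where "e = sqrt (1 - b\<^sup>2)"
  define E where "E = id_blinfun - (X o\<^sub>L X)"
  have b: "0 < b" "b \<le> 1" using \<open>0 < c\<close> by (simp_all add: b_def)
  then have b2: "0 < b\<^sup>2" "b\<^sup>2 \<le> 1" by (simp_all add: power_le_one)
  then have e: "0 \<le> e" "e < 1" by (simp_all add: e_def)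
  have Ex: "E x = x - X (X x)" for x
    by (simp add: E_def blinfun.diff_left)
  \<comment> \<open>By symmetry |x - X X x|^2 = |x|^2 - 2 |X x|^2 + |X X x|^2. The norm bound on X
    reduces this to at most |x|^2 - |X x|^2, and the lower bound on X to at most (1 - b^2)
    |x|^2.\<close>
  have "norm E \<le> e"
  proof (rule norm_blinfun_bound)
    fix x
    have "norm (X (X x)) \<le> norm (X x)"
      using norm_blinfun[of X "X x"] mult_right_mono[OF X(3), of "norm (X x)"] by simp
    then have "(norm (X (X x)))\<^sup>2 \<le> (norm (X x))\<^sup>2" by (intro power_mono) simp_all
    moreover have "(b * norm x)\<^sup>2 \<le> (norm (X x))\<^sup>2"
    proof (rule power_mono)
      show "b * norm x \<le> norm (X x)"
        using below[of x] mult_right_mono[of b c "norm x"] by (simp add: b_def)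
    qed (use b in simp)
    moreover have "re_ip x (X (X x)) = (norm (X x))\<^sup>2"
      by (simp add: re_symmetricD[OF X(2), symmetric] re_ip_self)
    ultimately have "(norm (E x))\<^sup>2 \<le> (norm x)\<^sup>2 - (b * norm x)\<^sup>2"
      unfolding Ex norm_diff_sq by linarith
    also have "\<dots> = (e * norm x)\<^sup>2" using b2 by (simp add: e_def power_mult_distrib algebra_simps)
    finally show "norm (E x) \<le> e * norm x"
      by (rule power2_le_imp_le) (use e in simp)
  qed (use e in simp)
  \<comment> \<open>The fixed point inherits symmetry and commutation with X from this closed set.
    The bound by \<open>e\<close> yields the contraction and, at the end, the positivity of
    \<open>K\<close>.\<close>
  let ?S = "{F \<in> left_multipliers A. re_symmetric F \<and> F o\<^sub>L X = X o\<^sub>L F \<and> norm F \<le> e}"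
  let ?f = "\<lambda>F. (1/2) *\<^sub>R (E + (F o\<^sub>L F))"
  note compose_diff = bounded_bilinear.diff_left[OF bounded_bilinear_blinfun_compose]
    bounded_bilinear.diff_right[OF bounded_bilinear_blinfun_compose]
  have normc: "norm (F o\<^sub>L G) \<le> u * v" if "norm F \<le> u" "norm G \<le> v" for F G :: "'h \<Rightarrow>\<^sub>L 'h" and u v
    using norm_blinfun_compose[of F G] mult_mono[OF that order_trans[OF norm_ge_zero that(1)]]
    by (rule order_trans) simp
  have "\<exists>!F\<in>?S. ?f F = F"
  proof (rule Banach_fix)
    have "closed (left_multipliers A \<inter> {F. re_symmetric F} \<inter> {F. F o\<^sub>L X = X o\<^sub>L F} \<inter> {F. norm F \<le> e})"
      using A by (intro closed_Int closed_left_multipliers closed_re_symmetric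
          cstar_subalgebraD closed_Collect_eq closed_Collect_le continuous_intros)
    then show "complete ?S" by (simp add: complete_eq_closed Collect_conj_eq Int_assoc)
    have "0 \<in> ?S"
      using e left_multipliersI(1)[OF A cstar_subalgebraD(3)[OF A]]
      by (simp add: re_symmetric_def re_ip.zero_left re_ip.zero_right)
    then show "?S \<noteq> {}" by blast
    show "?f ` ?S \<subseteq> ?S"
    proof safe
      fix F assume F: "F \<in> left_multipliers A" "re_symmetric F" and c: "F o\<^sub>L X = X o\<^sub>L F"
        and n: "norm F \<le> e"
      show "?f F \<in> left_multipliers A"
        unfolding E_def by (intro left_multipliersI A F X)
      show "re_symmetric (?f F)"
        by (simp add: re_symmetric_def Ex blinfun.bilinear_simps re_ip.bilinear_simps
            re_symmetricD[OF F(2)] re_symmetricD[OF X(2)])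
      have "F (X x) = X (F x)" for x using c by (metis blinfun_apply_blinfun_compose)
      then show "?f F o\<^sub>L X = X o\<^sub>L ?f F"
        by (intro blinfun_eqI) (simp add: Ex blinfun.bilinear_simps)
      have "norm (E + (F o\<^sub>L F)) \<le> e + e * e"
        using norm_triangle_mono[OF \<open>norm E \<le> e\<close> normc[OF n n]] .
      also have "\<dots> \<le> 2 * e" using e mult_left_mono[of e 1 e] by simp
      finally show "norm (?f F) \<le> e" by simp
    qed
    show "dist (?f F) (?f G) \<le> e * dist F G" if "F \<in> ?S" "G \<in> ?S" for F G
    proof -
      have "(F o\<^sub>L F) - (G o\<^sub>L G) = (F o\<^sub>L (F - G)) + ((F - G) o\<^sub>L G)"
        by (simp add: compose_diff)
      moreover have "norm \<dots> \<le> e * norm (F - G) + norm (F - G) * e"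
        using that by (intro norm_triangle_mono normc) auto
      ultimately have "norm ((F o\<^sub>L F) - (G o\<^sub>L G)) \<le> 2 * (e * norm (F - G))" by simp
      then show ?thesis
        by (simp add: dist_norm flip: scaleR_diff_right)
    qed
  qed (use e in auto)
  then obtain F where F: "F \<in> left_multipliers A" "re_symmetric F" "F o\<^sub>L X = X o\<^sub>L F" "norm F \<le> e"
    "?f F = F" by blast
  define K where "K = id_blinfun - F"
  have Kx: "K x = x - F x" for x by (simp add: K_def blinfun.diff_left)
  show thesis
  proof (rule that)
    show "K \<in> left_multipliers A" unfolding K_def by (intro left_multipliersI A F)
    show "re_symmetric K"
      by (simp add: re_symmetric_def Kx re_ip.bilinear_simps re_symmetricD[OF F(2)])
    show "K (X x) = X (K x)" for x
      using arg_cong[OF F(3), of "\<lambda>T. blinfun_apply T x"] by (simp add: Kx blinfun.diff_right)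
    show "K (K x) = X (X x)" for x
    proof -
      have "F x + F x = (x - X (X x)) + F (F x)"
        using arg_cong[OF F(5), of "\<lambda>T. blinfun_apply (2 *\<^sub>R T) x"]
        by (simp add: blinfun.bilinear_simps Ex scaleR_2)
      then show ?thesis by (simp add: Kx blinfun.diff_right algebra_simps)
    qed
    show "0 \<le> re_ip (K x) x" for x
    proof -
      have "norm (F x) \<le> norm x"
        using norm_blinfun[of F x] mult_right_mono[of "norm F" 1 "norm x"] F(4) e by simp
      then have "re_ip (F x) x \<le> norm x * norm x"
        using re_ip_le[of "F x" x] mult_right_mono[of "norm (F x)" "norm x" "norm x"] by simp
      then show ?thesis by (simp add: Kx re_ip.diff_left re_ip_self power2_eq_square)
    qed
  qed
qed

text \<open>\<open>N = (1 + J) / 2\<close> for \<open>J = \<bar>X\<bar> X\<^sup>-\<^sup>1\<close>, the sign of \<open>X\<close>.\<close>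

lemma positive_spectral_projection:
  assumes A: "cstar_subalgebra A" and X: "X \<in> left_multipliers A" "re_symmetric X"
    and Z: "Z \<in> left_multipliers A" "\<And>x. X (Z x) = x" "\<And>x. Z (X x) = x"
  obtains N where "N \<in> left_multipliers A" "re_symmetric N" "\<And>x. N (N x) = N x"
    "\<And>x. N x = x \<Longrightarrow> 0 \<le> re_ip (X x) x" "\<And>x. N x = 0 \<Longrightarrow> re_ip (X x) x \<le> 0"
proof -
  define a where "a = norm X + 1"
  have a: "0 < a" by (simp add: a_def add_nonneg_pos)
  \<comment> \<open>Rescaling to norm at most 1, as the square root requires; the summand 1 in
    \<open>a\<close> covers X = 0.\<close>
  define Y where "Y = (1 / a) *\<^sub>R X"
  define W where "W = a *\<^sub>R Z"
  have Y: "Y \<in> left_multipliers A" "re_symmetric Y" "W \<in> left_multipliers A"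
    unfolding Y_def W_def
    by (intro left_multipliersI(6) A X Z)
      (simp_all add: re_symmetric_def blinfun.scaleR_left re_ip.scaleR_left re_ip.scaleR_right
        re_symmetricD[OF X(2)] left_multipliersI(6) A Z)
  have YW: "Y (W x) = x" "W (Y x) = x" for x
    using a by (simp_all add: Y_def W_def blinfun.bilinear_simps Z)
  have "norm Y \<le> 1" using a by (simp add: Y_def a_def)
  moreover have "1 / (norm W + 1) * norm x \<le> norm (Y x)" for x
  proof -
    have "norm x \<le> norm W * norm (Y x)" using norm_blinfun[of W "Y x"] by (simp add: YW)
    also have "\<dots> \<le> (norm W + 1) * norm (Y x)" by (simp add: mult_right_mono)
    finally show ?thesis using add_nonneg_pos[of "norm W" 1] by (simp add: field_simps)
  qed
  moreover have "0 < 1 / (norm W + 1)" by (simp add: add_nonneg_pos)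
  ultimately obtain K where K: "K \<in> left_multipliers A" "re_symmetric K" "\<And>x. K (Y x) = Y (K x)"
    "\<And>x. K (K x) = Y (Y x)" "\<And>x. 0 \<le> re_ip (K x) x"
    using square_root_of_square[OF A Y(1,2)] by blast
  define J where "J = K o\<^sub>L W"
  define N where "N = (1/2) *\<^sub>R (id_blinfun + J)"
  have WK: "W (K x) = K (W x)" for x by (metis YW K(3))
  have W: "re_symmetric W" unfolding re_symmetric_def by (metis YW Y(2) re_symmetricD)
  have J: "re_symmetric J"
    by (simp add: re_symmetric_def J_def re_symmetricD[OF K(2)] re_symmetricD[OF W] WK)
  \<comment> \<open>K commutes with W = Y^-1 and K^2 = Y^2, hence J^2 = K^2 W^2 = 1, which makes
    \<open>N\<close> idempotent.\<close>
  have JJ: "J (J x) = x" for x by (simp add: J_def WK K(4) YW)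
  \<comment> \<open>Where N x = x, J is 1 and Y agrees with the positive K; where N x = 0, J is -1
    and Y agrees with -K.\<close>
  have YJ: "Y (J x) = K x" for x by (simp add: J_def YW flip: K(3))
  have Nx: "N x = (1/2) *\<^sub>R (x + J x)" for x by (simp add: N_def blinfun.bilinear_simps)
  have XY: "re_ip (X x) x = a * re_ip (Y x) x" for x
    using a by (simp add: Y_def blinfun.bilinear_simps re_ip.bilinear_simps)
  show thesis
  proof (rule that)
    show "N \<in> left_multipliers A" unfolding N_def J_def by (intro left_multipliersI A K Y)
    show "re_symmetric N"
      by (simp add: re_symmetric_def Nx re_ip.bilinear_simps re_symmetricD[OF J])
    show "N (N x) = N x" for x
      by (simp add: Nx blinfun.bilinear_simps JJ add.commute flip: scaleR_2 scaleR_add_right)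
    show "0 \<le> re_ip (X x) x" if "N x = x" for x
    proof -
      have "2 *\<^sub>R N x = x + x" using that by (simp add: scaleR_2)
      then have "J x = x" by (simp add: Nx)
      then have "re_ip (Y x) x = re_ip (K x) x" using YJ[of x] by simp
      then show ?thesis using K(5)[of x] a by (simp add: XY)
    qed
    show "re_ip (X x) x \<le> 0" if "N x = 0" for x
    proof -
      have "J x = - x" using that by (simp add: Nx eq_neg_iff_add_eq_0 add.commute)
      then have "K x = - Y x" using YJ[of x] by (simp add: blinfun.minus_right)
      then have "re_ip (Y x) x = - re_ip (K x) x" by (simp add: re_ip.minus_left)
      then show ?thesis using K(5)[of x] a by (simp add: XY mult_nonneg_nonpos)
    qed
  qed
qed

text \<open>\<open>D W D\<close> is the projection onto the range of \<open>D N\<close>, where \<open>W\<close> inverts \<open>N D\<^sup>2 N\<close> on the range of \<open>N\<close>.\<close>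

lemma range_projection:
  assumes A: "cstar_subalgebra A" and D: "D \<in> A" "re_symmetric D"
    and N: "N \<in> left_multipliers A" "re_symmetric N" "\<And>x. N (N x) = N x"
    and "0 < c" and below: "\<And>x. N x = x \<Longrightarrow> c * norm x \<le> norm (D x)"
  obtains W where "D o\<^sub>L (W o\<^sub>L D) \<in> A" "re_symmetric (D o\<^sub>L (W o\<^sub>L D))"
    "\<And>x. W (D (D (W x))) = W x" "\<And>x. N (D (D (W (D x)))) = N (D x)"
proof -
  \<comment> \<open>Adding 1 - N makes N D^2 N coercive on the whole space, so that
    \<open>coercive_inverse\<close> applies.\<close>
  define C where "C = (N o\<^sub>L (D o\<^sub>L (D o\<^sub>L N))) + (id_blinfun - N)"
  have D': "D \<in> left_multipliers A" by (rule left_multipliersI(1)[OF A D(1)])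
  have Cx: "C x = N (D (D (N x))) + (x - N x)" for x
    by (simp add: C_def blinfun.bilinear_simps)
  have C: "C \<in> left_multipliers A"
    unfolding C_def by (intro left_multipliersI(2-5) A N D')
  have Csym: "re_symmetric C"
    by (simp add: re_symmetric_def Cx re_ip.bilinear_simps re_symmetricD[OF N(2)] re_symmetricD[OF D(2)])
  have NN: "re_ip (x - N x) (N x) = 0" for x
    by (simp add: re_ip.diff_left re_symmetricD[OF N(2)] N(3))
  have coercive: "min (c\<^sup>2) 1 * (norm x)\<^sup>2 \<le> re_ip (C x) x" for x
  proof -
    have "(norm x)\<^sup>2 = (norm (N x))\<^sup>2 + (norm (x - N x))\<^sup>2"
      using norm_diff_sq[of x "N x"] NN[of x]
      by (simp add: re_ip.diff_left re_ip_self)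
    moreover have "re_ip (C x) x = (norm (D (N x)))\<^sup>2 + (norm (x - N x))\<^sup>2"
    proof -
      have "re_ip (N (D (D (N x)))) x = re_ip (D (N x)) (D (N x))"
        by (simp only: re_symmetricD[OF N(2)] re_symmetricD[OF D(2)])
      moreover have "re_ip (x - N x) x = re_ip (x - N x) (x - N x)"
        using NN[of x] by (simp add: re_ip.diff_right)
      ultimately show ?thesis by (simp add: Cx re_ip.add_left re_ip_self)
    qed
    moreover have "c\<^sup>2 * (norm (N x))\<^sup>2 \<le> (norm (D (N x)))\<^sup>2"
      using power_mono[OF below[OF N(3)[of x]], of 2] \<open>0 < c\<close> by (simp add: power_mult_distrib)
    moreover have "min (c\<^sup>2) 1 * (norm (N x))\<^sup>2 \<le> c\<^sup>2 * (norm (N x))\<^sup>2"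
      "min (c\<^sup>2) 1 * (norm (x - N x))\<^sup>2 \<le> 1 * (norm (x - N x))\<^sup>2"
      by (intro mult_right_mono; simp)+
    ultimately show ?thesis by (simp add: distrib_left)
  qed
  obtain V where V: "V \<in> left_multipliers A" "\<And>x. V (C x) = x" "\<And>x. C (V x) = x"
    using coercive_inverse[OF A C _ coercive] \<open>0 < c\<close> by auto
  have NC: "N (C x) = C (N x)" "N (C x) = N (D (D (N x)))" for x
    by (simp_all add: Cx blinfun.bilinear_simps N(3))
  have NV: "N (V x) = V (N x)" for x by (metis V NC(1))
  have Vsym: "re_symmetric V" unfolding re_symmetric_def by (metis V Csym re_symmetricD)
  define W where "W = V o\<^sub>L N"
  \<comment> \<open>N D^2 W = N is the key relation: it gives W D^2 W = V N D^2 W = V N = W, so D W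
    D is idempotent.\<close>
  have NDDW: "N (D (D (W x))) = N x" for x
    by (metis W_def blinfun_apply_blinfun_compose N(3) NC NV V(3))
  show thesis
  proof (rule that)
    have "W \<in> left_multipliers A" unfolding W_def by (intro left_multipliersI A V N)
    then show "D o\<^sub>L (W o\<^sub>L D) \<in> A"
      using D(1) cstar_subalgebraD(7)[OF A] by (simp add: left_multipliers_def)
    show "re_symmetric (D o\<^sub>L (W o\<^sub>L D))"
      by (simp add: re_symmetric_def W_def re_symmetricD[OF D(2)] re_symmetricD[OF N(2)]
          re_symmetricD[OF Vsym] NV)
    show "W (D (D (W x))) = W x" for x
      using NDDW[of x] by (simp add: W_def)
    show "N (D (D (W (D x)))) = N (D x)" for x by (rule NDDW)
  qed
qed

section \<open>Separating large from small values of a positive operator\<close>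

text \<open>Expand the positive form of D at x - t D x with t = 1 / |D|: the quadratic term is at
  most t |D x|^2, so half of the linear term 2 t |D x|^2 remains.\<close>

lemma norm_positive_le:
  fixes D :: "'h \<Rightarrow>\<^sub>L 'h"
  assumes "re_symmetric D" and pos: "\<And>x. 0 \<le> re_ip (D x) x"
  shows "(norm (D x))\<^sup>2 \<le> norm D * re_ip (D x) x"
proof (cases "D = 0")
  case False
  then have L: "0 < norm D" by simp
  define t where "t = 1 / norm D"
  have "re_ip (D (D x)) (D x) \<le> norm D * (norm (D x))\<^sup>2"
    using re_ip_le[of "D (D x)" "D x"] mult_right_mono[OF norm_blinfun[of D "D x"], of "norm (D x)"]
    by (simp add: power2_eq_square)
  then have "t\<^sup>2 * re_ip (D (D x)) (D x) \<le> t\<^sup>2 * (norm D * (norm (D x))\<^sup>2)"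
    by (intro mult_left_mono) simp_all
  also have "\<dots> = t * (norm (D x))\<^sup>2" using L by (simp add: t_def power2_eq_square)
  finally have "t\<^sup>2 * re_ip (D (D x)) (D x) \<le> t * (norm (D x))\<^sup>2" .
  moreover have "0 \<le> re_ip (D (x - t *\<^sub>R D x)) (x - t *\<^sub>R D x)" by (rule pos)
  then have "0 \<le> re_ip (D x) x - 2 * t * (norm (D x))\<^sup>2 + t\<^sup>2 * re_ip (D (D x)) (D x)"
    using re_symmetricD[OF assms(1), of "D x" x]
    by (simp add: blinfun.bilinear_simps re_ip.bilinear_simps re_ip_self power2_eq_square algebra_simps)
  ultimately have "t * (norm (D x))\<^sup>2 \<le> re_ip (D x) x" by linarith
  then show ?thesis using L by (simp add: t_def field_simps)
qed (simp add: re_ip.zero_left)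

text \<open>An adjoint S of e in A satisfies S = e S, and e S is its own adjoint; hence so is
  e.\<close>

lemma unit_re_symmetric:
  assumes A: "cstar_subalgebra A" and e: "is_unit_of A e"
  shows "re_symmetric e"
proof -
  obtain S where S: "S \<in> A" "\<And>x y. ip (e x) y = ip x (S y)"
    using A e unfolding cstar_subalgebra_def is_unit_of_def is_adjoint_def by meson
  have "e (S x) = S x" for x using e S(1) by (metis is_unit_of_def blinfun_apply_blinfun_compose)
  then have SS: "ip (S x) (S y) = ip (S x) y" for x y by (metis S(2))
  have "ip (e x) y = ip x (e y)" for x y by (metis S(2) SS ip_commute)
  then show ?thesis by (intro selfadjoint_imp_re_symmetric) (simp add: selfadjoint_def is_adjoint_def)
qed

text \<open>Turns real rank zero into invertibility on the whole space with an inverse among the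
  left multipliers, so that later arguments treat algebras with and without unit alike.\<close>

lemma approx_invertible:
  assumes A: "cstar_subalgebra A" and rr: "real_rank_zero A"
    and D: "D \<in> A" "re_symmetric D" and d: "0 < d" and "0 < h"
  obtains X Z where "X \<in> left_multipliers A" "re_symmetric X" "Z \<in> left_multipliers A"
    "\<And>x. X (Z x) = x" "\<And>x. Z (X x) = x" "norm (X - (D - d *\<^sub>R id_blinfun)) < h"
proof (cases "\<exists>e. is_unit_of A e")
  case True
  then obtain e where e: "is_unit_of A e" by blast
  then have eA: "e \<in> A" and eT: "\<And>T x. T \<in> A \<Longrightarrow> e (T x) = T x" "\<And>T x. T \<in> A \<Longrightarrow> T (e x) = T x"
    unfolding is_unit_of_def by (metis blinfun_apply_blinfun_compose)+
  have U: "unitization A = A" using True by (simp add: unitization_def)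
  have "D - d *\<^sub>R e \<in> A" by (intro cstar_subalgebraD(5) cstar_subalgebra_scaleR A D eA)
  moreover have "re_symmetric (D - d *\<^sub>R e)"
    by (simp add: re_symmetric_def blinfun.bilinear_simps re_ip.bilinear_simps re_symmetricD[OF D(2)]
        re_symmetricD[OF unit_re_symmetric[OF A e]])
  ultimately have "D - d *\<^sub>R e \<in> {T \<in> unitization A. selfadjoint T}"
    using re_symmetric_imp_selfadjoint cstar_subalgebraD(1)[OF A] U by auto
  with rr \<open>0 < h\<close> obtain X where X: "X \<in> A" "selfadjoint X" "invertible_in A X" "dist X (D - d *\<^sub>R e) < h"
    unfolding real_rank_zero_def U closure_approachable subset_iff by (metis (no_types, lifting) mem_Collect_eq)
  then obtain Z e1 where Z: "Z \<in> A" "is_unit_of A e1" "Z o\<^sub>L X = e1" "X o\<^sub>L Z = e1"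
    unfolding invertible_in_def by blast
  have "e1 = e" using e Z(2) unfolding is_unit_of_def by metis
  with Z have ZX: "Z (X x) = e x" "X (Z x) = e x" for x
    by (metis blinfun_apply_blinfun_compose)+
  \<comment> \<open>\<open>X\<close> is invertible only relative to \<open>e\<close>; complete it by \<open>- d\<close> on the complement of \<open>e\<close>.\<close>
  define X' where "X' = X - d *\<^sub>R (id_blinfun - e)"
  define Z' where "Z' = Z - (1 / d) *\<^sub>R (id_blinfun - e)"
  have app: "X' x = X x - d *\<^sub>R (x - e x)" "Z' x = Z x - (1 / d) *\<^sub>R (x - e x)" for x
    by (simp_all add: X'_def Z'_def blinfun.bilinear_simps)
  show thesis
  proof (rule that)
    show "X' \<in> left_multipliers A" unfolding X'_def
      using left_multipliersI(1)[OF A] X eA by (intro left_multipliersI(2-6)[OF A]) auto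
    show "Z' \<in> left_multipliers A" unfolding Z'_def
      using left_multipliersI(1)[OF A] Z eA by (intro left_multipliersI(2-6)[OF A]) auto
    show "re_symmetric X'"
      by (simp add: re_symmetric_def app re_ip.bilinear_simps
          re_symmetricD[OF selfadjoint_imp_re_symmetric[OF X(2)]]
          re_symmetricD[OF unit_re_symmetric[OF A e]])
    show "X' (Z' x) = x" "Z' (X' x) = x" for x
      using d by (simp_all add: app blinfun.bilinear_simps ZX eT X(1) Z(1) eA)
    \<comment> \<open>The completion adds the same operator -d (1 - e) to X and to D - d e, so their
      distance is unchanged.\<close>
    have "X' - (D - d *\<^sub>R id_blinfun) = X - (D - d *\<^sub>R e)"
      by (simp add: X'_def algebra_simps)
    then show "norm (X' - (D - d *\<^sub>R id_blinfun)) < h" using X(4) by (simp only: dist_norm)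
  qed
next
  case False
  let ?U = "{T + scale_op c id_blinfun |T c. T \<in> A}"
  have U: "unitization A = ?U" using False by (simp add: unitization_def)
  have lm: "T \<in> left_multipliers A" if "T \<in> ?U" for T
    using that left_multipliersI[OF A] by auto
  have "id_blinfun = 0 + scale_op 1 id_blinfun" by (rule blinfun_eqI) simp
  then have id: "id_blinfun \<in> ?U" using cstar_subalgebraD(3)[OF A] by blast
  have eq: "D - d *\<^sub>R id_blinfun = D + scale_op (of_real (- d)) id_blinfun"
    by (rule blinfun_eqI) (simp add: blinfun.bilinear_simps scale_of_real del: of_real_minus)
  then have "D - d *\<^sub>R id_blinfun \<in> ?U" using D by blast
  moreover have "D - d *\<^sub>R id_blinfun \<in> bounded_ops"
    unfolding eq using cstar_subalgebraD(1)[OF A] D(1)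
    by (auto simp: bounded_ops_def blinfun.add_left scale_right_diff_distrib mult.commute)
  moreover have "re_symmetric (D - d *\<^sub>R id_blinfun)"
    by (simp add: re_symmetric_def blinfun.bilinear_simps re_ip.bilinear_simps re_symmetricD[OF D(2)])
  ultimately have "D - d *\<^sub>R id_blinfun \<in> {T \<in> unitization A. selfadjoint T}"
    using re_symmetric_imp_selfadjoint U by auto
  with rr \<open>0 < h\<close> obtain X where X: "X \<in> ?U" "selfadjoint X" "invertible_in ?U X"
      "dist X (D - d *\<^sub>R id_blinfun) < h"
    unfolding real_rank_zero_def U closure_approachable subset_iff by (metis (no_types, lifting) mem_Collect_eq)
  then obtain Z e where Z: "Z \<in> ?U" "is_unit_of ?U e" "Z o\<^sub>L X = e" "X o\<^sub>L Z = e"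
    unfolding invertible_in_def by blast
  \<comment> \<open>Since \<open>?U\<close> contains the identity operator, its unit can only be the
    identity.\<close>
  have "e o\<^sub>L id_blinfun = id_blinfun" using Z(2) id unfolding is_unit_of_def by blast
  then have "e x = x" for x by (metis blinfun_apply_blinfun_compose blinfun_apply_id_blinfun)
  with Z have "Z (X x) = x" "X (Z x) = x" for x
    by (metis blinfun_apply_blinfun_compose)+
  then show thesis
    using that[of X Z] lm X Z selfadjoint_imp_re_symmetric by (simp add: dist_norm)
qed

text \<open>Here D W D is the projection onto the range of D N, with N the positive spectral
  projection of X. The conclusion keeps the factored form because it shows that the projection
  vanishes wherever D does.\<close>

lemma exists_separating_projection:
  assumes A: "cstar_subalgebra A" and rr: "real_rank_zero A"
    and D: "D \<in> A" "re_symmetric D" "\<And>x. 0 \<le> re_ip (D x) x" and "0 < \<epsilon>"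
  obtains W where "D o\<^sub>L (W o\<^sub>L D) \<in> A" "re_symmetric (D o\<^sub>L (W o\<^sub>L D))" "\<And>x. W (D (D (W x))) = W x"
    "\<And>x. D (W (D x)) = 0 \<Longrightarrow> norm (D x) \<le> \<epsilon> * norm x"
proof -
  \<comment> \<open>Where N x = 0, the form of D is at most 2 d |x|^2, hence |D x|^2 \<le> 2 d |D|
    |x|^2, and this d makes the bound at most \<epsilon>^2 |x|^2.\<close>
  define d where "d = \<epsilon>\<^sup>2 / (2 * (norm D + 1))"
  have D1: "0 < norm D + 1" by (simp add: add_nonneg_pos)
  then have d: "0 < d" using \<open>0 < \<epsilon>\<close> by (simp add: d_def)
  obtain X Z where X: "X \<in> left_multipliers A" "re_symmetric X"
    and Z: "Z \<in> left_multipliers A" "\<And>x. X (Z x) = x" "\<And>x. Z (X x) = x"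
    and close: "norm (X - (D - d *\<^sub>R id_blinfun)) < d / 2"
    using approx_invertible[OF A rr D(1,2) d, of "d / 2"] d by auto
  obtain N where N: "N \<in> left_multipliers A" "re_symmetric N" "\<And>x. N (N x) = N x"
    and Npos: "\<And>x. N x = x \<Longrightarrow> 0 \<le> re_ip (X x) x"
    and Nneg: "\<And>x. N x = 0 \<Longrightarrow> re_ip (X x) x \<le> 0"
    using positive_spectral_projection[OF A X Z] by blast
  define Y where "Y = X - (D - d *\<^sub>R id_blinfun)"
  have XY: "re_ip (X x) x = re_ip (D x) x - d * (norm x)\<^sup>2 + re_ip (Y x) x" for x
    by (simp add: Y_def blinfun.bilinear_simps re_ip.bilinear_simps re_ip_self)
  have Yx: "\<bar>re_ip (Y x) x\<bar> \<le> d / 2 * (norm x)\<^sup>2" for x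
  proof -
    have "\<bar>re_ip (Y x) x\<bar> \<le> norm (Y x) * norm x"
      using re_ip_le[of "Y x" x] re_ip_le[of "- Y x" x] by (simp add: re_ip.minus_left)
    also have "\<dots> \<le> (norm Y * norm x) * norm x" by (intro mult_right_mono norm_blinfun) simp
    also have "\<dots> \<le> (d / 2 * norm x) * norm x"
      using close by (intro mult_right_mono) (simp_all add: Y_def)
    finally show ?thesis by (simp add: power2_eq_square)
  qed
  have below: "d / 2 * norm x \<le> norm (D x)" if "N x = x" for x
  proof (cases "x = 0")
    case False
    have "d / 2 * (norm x)\<^sup>2 \<le> re_ip (D x) x"
      using Npos[OF that] Yx[of x] unfolding XY by linarith
    also have "\<dots> \<le> norm (D x) * norm x" by (rule re_ip_le)
    finally show ?thesis using False by (simp add: power2_eq_square)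
  qed simp
  have above: "norm (D x) \<le> \<epsilon> * norm x" if "N x = 0" for x
  proof -
    have "re_ip (D x) x \<le> 2 * d * (norm x)\<^sup>2"
      using Nneg[OF that] Yx[of x] d mult_nonneg_nonneg[of d "(norm x)\<^sup>2"] unfolding XY by linarith
    then have "norm D * re_ip (D x) x \<le> norm D * (2 * d * (norm x)\<^sup>2)"
      by (intro mult_left_mono) simp_all
    also have "\<dots> = (norm D / (norm D + 1)) * (\<epsilon>\<^sup>2 * (norm x)\<^sup>2)"
      using D1 by (simp add: d_def field_simps)
    also have "\<dots> \<le> 1 * (\<epsilon>\<^sup>2 * (norm x)\<^sup>2)" using D1 by (intro mult_right_mono) simp_all
    finally have "(norm (D x))\<^sup>2 \<le> (\<epsilon> * norm x)\<^sup>2"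
      using norm_positive_le[OF D(2,3), of x] by (simp add: power_mult_distrib)
    then show ?thesis by (rule power2_le_imp_le) (use \<open>0 < \<epsilon>\<close> in simp)
  qed
  obtain W where W: "D o\<^sub>L (W o\<^sub>L D) \<in> A" "re_symmetric (D o\<^sub>L (W o\<^sub>L D))"
    "\<And>x. W (D (D (W x))) = W x" "\<And>x. N (D (D (W (D x)))) = N (D x)"
    using range_projection[OF A D(1,2) N _ below] d by auto
  \<comment> \<open>The estimate \<open>above\<close> is applied to D x instead of x; writing |D
    x|^2 as \<open>re_ip (D (D x)) x\<close> then allows one factor |D x| to be cancelled.\<close>
  have "norm (D x) \<le> \<epsilon> * norm x" if "D (W (D x)) = 0" for x
  proof (cases "D x = 0")
    case False
    have "N (D x) = 0" using W(4)[of x] that by (simp add: blinfun.zero_right)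
    then have "norm (D (D x)) \<le> \<epsilon> * norm (D x)" by (rule above)
    have "(norm (D x))\<^sup>2 = re_ip (D (D x)) x"
      by (simp add: re_symmetricD[OF D(2)] re_ip_self)
    also have "\<dots> \<le> norm (D (D x)) * norm x" by (rule re_ip_le)
    also have "\<dots> \<le> (\<epsilon> * norm (D x)) * norm x"
      using \<open>norm (D (D x)) \<le> _\<close> by (rule mult_right_mono) simp
    finally show ?thesis using False by (simp add: power2_eq_square)
  qed (use \<open>0 < \<epsilon>\<close> in simp)
  with W(1-3) that show thesis by blast
qed

section \<open>Projections of the algebra and the decreasing sequence\<close>

lemma projections_iff:
  assumes "A \<subseteq> bounded_ops"
  shows "P \<in> projections A \<longleftrightarrow> P \<in> A \<and> re_symmetric P \<and> (\<forall>x. P (P x) = P x)"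
proof -
  have "P o\<^sub>L P = P \<longleftrightarrow> (\<forall>x. P (P x) = P x)"
    by (metis blinfun_apply_blinfun_compose blinfun_eqI)
  then show ?thesis
    using assms re_symmetric_imp_selfadjoint selfadjoint_imp_re_symmetric
    by (auto simp: projections_def)
qed

lemma re_ip_eqI: "(\<And>z. re_ip x z = re_ip y z) \<Longrightarrow> x = y" for x y :: 'h
  using re_ip_self[of "x - y"] by (simp add: re_ip.diff_left)

text \<open>Taking adjoints turns P Q = P into Q P = P, which expresses the order through fixed
  vectors.\<close>

lemma proj_le_iff:
  fixes P Q :: "'h \<Rightarrow>\<^sub>L 'h"
  assumes "re_symmetric P" "re_symmetric Q"
  shows "proj_le P Q \<longleftrightarrow> (\<forall>x. Q (P x) = P x)"
proof -
  have "proj_le P Q \<longleftrightarrow> (\<forall>x. P (Q x) = P x)"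
    unfolding proj_le_def by (metis blinfun_apply_blinfun_compose blinfun_eqI)
  also have "\<dots> \<longleftrightarrow> (\<forall>x. Q (P x) = P x)"
    by (metis assms re_symmetricD re_ip_eqI re_ip_commute)
  finally show ?thesis .
qed

lemma shrink_projection:
  fixes P :: "nat \<Rightarrow> 'h \<Rightarrow>\<^sub>L 'h"
  assumes A: "cstar_subalgebra A" and rr: "real_rank_zero A"
    and P: "\<And>i. P i \<in> projections A" and Q: "Q \<in> projections A" and "0 < \<epsilon>"
  obtains R where "R \<in> projections A" "proj_le R Q"
    "\<And>x. Q x = x \<Longrightarrow> (\<And>i. i \<le> n \<Longrightarrow> P i x = x) \<Longrightarrow> R x = x"
    "\<And>x i. R x = x \<Longrightarrow> i \<le> n \<Longrightarrow> (norm (x - P i x))\<^sup>2 \<le> \<epsilon> * (norm x)\<^sup>2"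
proof -
  note proj = projections_iff[OF cstar_subalgebraD(1)[OF A]]
  have P': "P i \<in> A" "re_symmetric (P i)" "P i (P i x) = P i x" for i x
    using P by (auto simp: proj)
  have Q': "Q \<in> A" "re_symmetric Q" "Q (Q x) = Q x" for x
    using Q by (auto simp: proj)
  \<comment> \<open>The form of D at x is the sum of the squared distances from Q x to the ranges of
    the \<open>P i\<close>. Compressing by Q puts the projection D W D below Q.\<close>
  define D where "D = (\<Sum>i\<le>n. Q - (Q o\<^sub>L (P i o\<^sub>L Q)))"
  have Dx: "D x = (\<Sum>i\<le>n. Q (Q x - P i (Q x)))" for x
    by (simp add: D_def blinfun.sum_left blinfun.bilinear_simps Q'(3))
  have sumA: "(\<Sum>i\<in>I. f i) \<in> A" if "\<And>i. f i \<in> A" "finite I" for f and I :: "nat set"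
    using that(2) by (induction rule: finite_induct) (simp_all add: cstar_subalgebraD[OF A] that(1))
  have DA: "D \<in> A" unfolding D_def by (intro sumA cstar_subalgebraD(5,7)[OF A] Q' P') simp
  have Dsym: "re_symmetric D"
    by (simp add: re_symmetric_def Dx re_ip.sum_left re_ip.sum_right re_symmetricD[OF Q'(2)]
        blinfun.diff_right re_ip.bilinear_simps re_symmetricD[OF P'(2)] Q'(3))
  have Dip: "re_ip (D x) x = (\<Sum>i\<le>n. (norm (Q x - P i (Q x)))\<^sup>2)" for x
    by (simp add: Dx re_ip.sum_left re_symmetricD[OF Q'(2)] re_symmetricD[OF P'(2)] re_ip.bilinear_simps
        P'(3) flip: re_ip_self)
  then have Dpos: "0 \<le> re_ip (D x) x" for x by (simp add: sum_nonneg)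
  obtain W where W: "D o\<^sub>L (W o\<^sub>L D) \<in> A" "re_symmetric (D o\<^sub>L (W o\<^sub>L D))" "\<And>x. W (D (D (W x))) = W x"
    "\<And>x. D (W (D x)) = 0 \<Longrightarrow> norm (D x) \<le> \<epsilon> * norm x"
    using exists_separating_projection[OF A rr DA Dsym Dpos \<open>0 < \<epsilon>\<close>] by blast
  define N where "N = D o\<^sub>L (W o\<^sub>L D)"
  have Nx: "N x = D (W (D x))" for x by (simp add: N_def)
  have N: "N \<in> A" "re_symmetric N" using W by (simp_all add: N_def)
  have NN: "N (N x) = N x" for x by (simp add: Nx W(3))
  have QD: "Q (D x) = D x" for x by (simp add: Dx blinfun.sum_right Q'(3))
  then have QN: "Q (N x) = N x" for x by (simp add: Nx)
  have DQ: "D (Q x) = D x" for x by (simp add: Dx Q'(3))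
  then have NQ: "N (Q x) = N x" for x by (simp add: Nx)
  define R where "R = Q - N"
  have Rx: "R x = Q x - N x" for x by (simp add: R_def blinfun.diff_left)
  have R: "R \<in> A" "re_symmetric R" "\<And>x. R (R x) = R x"
    unfolding R_def using Q' N cstar_subalgebraD(5)[OF A]
    by (auto simp: re_symmetric_def blinfun.bilinear_simps re_ip.bilinear_simps NN QN NQ)
  show thesis
  proof (rule that)
    show "R \<in> projections A" by (simp add: proj R)
    show "proj_le R Q"
      using R(2) Q'(2) by (simp add: proj_le_iff Rx blinfun.diff_right Q'(3) QN)
    show "R x = x" if "Q x = x" "\<And>i. i \<le> n \<Longrightarrow> P i x = x" for x
    proof -
      have "D x = 0" using that by (simp add: Dx blinfun.zero_right)
      with that(1) show ?thesis by (simp add: Rx Nx blinfun.zero_right)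
    qed
    show "(norm (x - P i x))\<^sup>2 \<le> \<epsilon> * (norm x)\<^sup>2" if "R x = x" "i \<le> n" for x i
    proof -
      \<comment> \<open>A vector fixed by R = Q - N lies in the range of Q and in the kernel of N =
        D W D.\<close>
      have Qx: "Q x = x" by (metis Rx that(1) QN Q'(3) blinfun.diff_right)
      then have "D (W (D x)) = 0" using that(1) by (simp add: Rx Nx)
      then have "norm (D x) \<le> \<epsilon> * norm x" by (rule W(4))
      have "(norm (x - P i x))\<^sup>2 \<le> re_ip (D x) x"
        unfolding Dip Qx using that(2) by (intro member_le_sum) simp_all
      also have "\<dots> \<le> norm (D x) * norm x" by (rule re_ip_le)
      also have "\<dots> \<le> (\<epsilon> * norm x) * norm x"
        using \<open>norm (D x) \<le> _\<close> by (rule mult_right_mono) simp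
      finally show ?thesis by (simp add: power2_eq_square)
    qed
  qed
qed

text \<open>Fixed vectors express the comparison of ranges, so no meet has to be constructed. The
  bound for each single n is what the claim about finite meets uses.\<close>

lemma exists_decreasing_sequence:
  fixes P :: "nat \<Rightarrow> 'h \<Rightarrow>\<^sub>L 'h"
  assumes A: "cstar_subalgebra A" and rr: "real_rank_zero A"
    and P: "\<And>i. P i \<in> projections A"
  obtains Q where "\<And>n. Q n \<in> projections A" "proj_decreasing Q"
    "\<And>n x. (\<And>i. i \<le> n \<Longrightarrow> P i x = x) \<Longrightarrow> Q n x = x"
    "\<And>x i. (\<And>n. Q n x = x) \<Longrightarrow> P i x = x"
proof -
  note proj = projections_iff[OF cstar_subalgebraD(1)[OF A]]
  let ?inv = "\<lambda>n Q. Q \<in> projections A \<and> (\<forall>x. (\<forall>i\<le>n. P i x = x) \<longrightarrow> Q x = x)"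
  \<comment> \<open>Step n tests \<open>P 0\<close> to \<open>P n\<close> on the fixed vectors of
    \<open>Q (Suc n)\<close>, with a tolerance tending to 0.\<close>
  let ?step = "\<lambda>n Q R. proj_le R Q \<and>
    (\<forall>x i. R x = x \<longrightarrow> i \<le> n \<longrightarrow> (norm (x - P i x))\<^sup>2 \<le> inverse (real (Suc n)) * (norm x)\<^sup>2)"
  have "\<exists>Q. \<forall>n. ?inv n (Q n) \<and> ?step n (Q n) (Q (Suc n))"
  proof (rule dependent_nat_choice)
    show "\<exists>Q. ?inv 0 Q" using P by blast
    fix Q n assume inv: "?inv n Q"
    obtain R where R: "R \<in> projections A" "proj_le R Q"
      "\<And>x. Q x = x \<Longrightarrow> (\<And>i. i \<le> n \<Longrightarrow> P i x = x) \<Longrightarrow> R x = x"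
      "\<And>x i. R x = x \<Longrightarrow> i \<le> n \<Longrightarrow> (norm (x - P i x))\<^sup>2 \<le> inverse (real (Suc n)) * (norm x)\<^sup>2"
      by (rule shrink_projection[where P = P and n = n and \<epsilon> = "inverse (real (Suc n))", OF A rr P conjunct1[OF inv]])
        auto
    have "R x = x" if "\<forall>i\<le>Suc n. P i x = x" for x
      using R(3) inv that by simp
    then have "?inv (Suc n) R \<and> ?step n Q R" using R(1,2,4) by simp
    then show "\<exists>R. ?inv (Suc n) R \<and> ?step n Q R" ..
  qed
  then obtain Q where step: "\<forall>n. ?inv n (Q n) \<and> ?step n (Q n) (Q (Suc n))" ..
  have Q: "?inv n (Q n)" "?step n (Q n) (Q (Suc n))" for n
    by (rule conjunct1[OF spec[OF step]], rule conjunct2[OF spec[OF step]])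
  have sym: "re_symmetric (Q n)" for n using Q(1)[of n] by (simp add: proj)
  have QQ: "Q n (Q (Suc n) x) = Q (Suc n) x" for n x
    using Q(2)[of n] proj_le_iff[OF sym sym] by blast
  have QQ': "Q m (Q n x) = Q n x" if "m \<le> n" for m n x
    using that
  proof (induction arbitrary: x rule: dec_induct)
    case base
    show ?case using Q(1)[of m] by (simp add: proj)
  next
    case (step n)
    then show ?case using step.IH[of "Q (Suc n) x"] by (simp add: QQ)
  qed
  show thesis
  proof (rule that)
    show "Q n \<in> projections A" for n using Q by blast
    show "proj_decreasing Q"
      unfolding proj_decreasing_def using QQ' by (simp add: proj_le_iff sym)
    show "Q n x = x" if "\<And>i. i \<le> n \<Longrightarrow> P i x = x" for n x
      using Q(1) that by blast
    show "P i x = x" if "\<And>n. Q n x = x" for x i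
    proof -
      \<comment> \<open>For fixed i every step n \<ge> i bounds the distance, and n tends to
        infinity.\<close>
      have "(norm (x - P i x))\<^sup>2 \<le> 0 * (norm x)\<^sup>2"
      proof (rule LIMSEQ_le_const)
        show "(\<lambda>n. inverse (real (Suc n)) * (norm x)\<^sup>2) \<longlonglongrightarrow> 0 * (norm x)\<^sup>2"
          by (intro tendsto_mult LIMSEQ_inverse_real_of_nat tendsto_const)
        show "\<exists>N. \<forall>n\<ge>N. (norm (x - P i x))\<^sup>2 \<le> inverse (real (Suc n)) * (norm x)\<^sup>2"
        proof (intro exI allI impI)
          fix n assume "i \<le> n"
          then show "(norm (x - P i x))\<^sup>2 \<le> inverse (real (Suc n)) * (norm x)\<^sup>2"
            using Q(2)[of n] that[of "Suc n"] by simp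
        qed
      qed
      then show ?thesis by simp
    qed
  qed
qed

section \<open>Greatest lower bounds and finite meets\<close>

text \<open>Antisymmetry of the order makes greatest lower bounds unique, which resolves the
  definite description in \<open>meet\<close>.\<close>

lemma meet_eqI:
  assumes "is_glb_in (projections bounded_ops) \<P> Q"
  shows "meet \<P> = Q"
  unfolding meet_def
proof (rule the_equality)
  fix R assume R: "is_glb_in (projections bounded_ops) \<P> R"
  then have "re_symmetric Q" "re_symmetric R"
    using assms by (auto simp: is_glb_in_def projections_iff)
  moreover have "proj_le Q R" "proj_le R Q"
    using R assms by (auto simp: is_glb_in_def)
  ultimately show "R = Q"
    by (metis proj_le_def proj_le_iff blinfun_apply_blinfun_compose blinfun_eqI)
qed (rule assms)

text \<open>Both sequences have the same lower bounds among all projections on the space, so the two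
  definite descriptions have the same predicate.\<close>

lemma exists_decreasing_sequence_same_meet:
  fixes P :: "nat \<Rightarrow> 'h \<Rightarrow>\<^sub>L 'h"
  assumes A: "cstar_subalgebra A" and rr: "real_rank_zero A"
    and P: "\<forall>n. P n \<in> projections A"
  shows "\<exists>Q. (\<forall>n. Q n \<in> projections A) \<and> proj_decreasing Q \<and> meet (range P) = meet (range Q)"
proof -
  have sym: "re_symmetric R" if "R \<in> projections B" "B \<subseteq> bounded_ops" for R B
    using that by (simp add: projections_iff)
  note symA = sym[OF _ cstar_subalgebraD(1)[OF A]]
  obtain Q where Q: "\<And>n. Q n \<in> projections A" "proj_decreasing Q"
    "\<And>n x. (\<And>i. i \<le> n \<Longrightarrow> P i x = x) \<Longrightarrow> Q n x = x"
    "\<And>x i. (\<And>n. Q n x = x) \<Longrightarrow> P i x = x"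
    using exists_decreasing_sequence[OF A rr, of P] P by blast
  have "(\<forall>n. proj_le R (P n)) \<longleftrightarrow> (\<forall>n. proj_le R (Q n))" if "R \<in> projections bounded_ops" for R
  proof -
    have iff: "proj_le R S \<longleftrightarrow> (\<forall>x. S (R x) = R x)" if "S \<in> projections A" for S
      using sym[OF \<open>R \<in> _\<close> order_refl] symA[OF that] by (rule proj_le_iff)
    show ?thesis
    proof
      assume "\<forall>n. proj_le R (P n)"
      then have "P n (R x) = R x" for n x using P iff by blast
      then have "Q n (R x) = R x" for n x by (intro Q(3))
      then show "\<forall>n. proj_le R (Q n)" using iff[OF Q(1)] by simp
    next
      assume "\<forall>n. proj_le R (Q n)"
      then have "Q n (R x) = R x" for n x using Q(1) iff by blast
      then have "P n (R x) = R x" for n x by (intro Q(4))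
      then show "\<forall>n. proj_le R (P n)" using iff P by simp
    qed
  qed
  then have "is_glb_in (projections bounded_ops) (range P) R
      \<longleftrightarrow> is_glb_in (projections bounded_ops) (range Q) R" for R
    unfolding is_glb_in_def by auto
  then have "is_glb_in (projections bounded_ops) (range P) = is_glb_in (projections bounded_ops) (range Q)"
    by (rule ext)
  then have "meet (range P) = meet (range Q)" unfolding meet_def by simp
  then show ?thesis using Q(1,2) by blast
qed

lemma sigma_closed_glb_eq_finite_meet:
  fixes P :: "nat \<Rightarrow> 'h \<Rightarrow>\<^sub>L 'h"
  assumes A: "cstar_subalgebra A" and rr: "real_rank_zero A"
    and P: "\<forall>n. P n \<in> projections A"
    and sc: "sigma_closed (projections A)" and glb: "is_glb_in (projections A) (range P) Q"
  shows "\<exists>m. Q = meet (P ` {..m})"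
proof -
  note proj = projections_iff[OF cstar_subalgebraD(1)[OF A]]
  have Q: "Q \<in> projections A" "Q \<in> A" "re_symmetric Q" "\<And>x. Q (Q x) = Q x"
    using glb by (auto simp: is_glb_in_def proj)
  have P': "P i \<in> A" "re_symmetric (P i)" "P i (P i x) = P i x" for i x
    using P by (auto simp: proj)
  have "proj_le Q (P i)" for i using glb by (auto simp: is_glb_in_def)
  then have PQ: "P i (Q x) = Q x" "Q (P i x) = Q x" for i x
    using proj_le_iff[OF Q(3) P'(2)] by (auto simp: proj_le_def simp flip: blinfun_apply_blinfun_compose)
  have "P i - Q \<in> projections A" for i
    using cstar_subalgebraD(5)[OF A P'(1) Q(2)]
    by (simp add: proj re_symmetric_def blinfun.bilinear_simps re_ip.bilinear_simps PQ Q P'(3)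
        re_symmetricD[OF Q(3)] re_symmetricD[OF P'(2)])
  then obtain R where R: "\<And>n. R n \<in> projections A" "proj_decreasing R"
    "\<And>n x. (\<And>i. i \<le> n \<Longrightarrow> (P i - Q) x = x) \<Longrightarrow> R n x = x"
    "\<And>x i. (\<And>n. R n x = x) \<Longrightarrow> (P i - Q) x = x"
    using exists_decreasing_sequence[OF A rr, of "\<lambda>i. P i - Q"] by blast
  \<comment> \<open>Otherwise a non-zero S in A lies below every \<open>R n\<close>, hence below
    every \<open>P i - Q\<close>. Then S is orthogonal to Q and below every \<open>P i\<close>, so
    it is also below Q, a contradiction.\<close>
  have "\<exists>m. R m = 0"
  proof (rule ccontr)
    assume "\<nexists>m. R m = 0"
    then have "\<forall>n. R n \<in> projections A - {0}" using R(1) by blast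
    then obtain S where S: "S \<in> projections A" "S \<noteq> 0" "\<And>n. proj_le S (R n)"
      using sc R(2) unfolding sigma_closed_def by blast
    have symS: "re_symmetric S" using S(1) by (simp add: proj)
    have "R n (S x) = S x" for n x
      using S(3) proj_le_iff[OF symS] R(1) by (simp add: proj)
    then have PS: "P i (S x) - Q (S x) = S x" for i x
      using R(4) by (metis blinfun.diff_left)
    have QS: "Q (S x) = 0" for x
      using arg_cong[OF PS[of 0 x], of Q] by (simp add: blinfun.diff_right PQ Q(4))
    then have "P i (S x) = S x" for i x using PS[of i x] by simp
    then have "proj_le S (P i)" for i by (simp add: proj_le_iff symS P'(2))
    then have "proj_le S Q" using glb S(1) by (auto simp: is_glb_in_def)
    then have "Q (S x) = S x" for x using proj_le_iff[OF symS Q(3)] by blast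
    with QS S(2) show False by (metis blinfun_eqI blinfun.zero_left)
  qed
  then obtain m where m: "R m = 0" by blast
  have "is_glb_in (projections bounded_ops) (P ` {..m}) Q"
    unfolding is_glb_in_def
  proof (intro conjI ballI impI)
    show "Q \<in> projections bounded_ops"
      using Q(1) cstar_subalgebraD(1)[OF A] by (auto simp: projections_def)
    show "proj_le Q T" if "T \<in> P ` {..m}" for T
      using that \<open>\<And>i. proj_le Q (P i)\<close> by blast
    fix T assume T: "T \<in> projections bounded_ops" "\<forall>U\<in>P ` {..m}. proj_le T U"
    have symT: "re_symmetric T" using T(1) by (simp add: projections_iff)
    have PT: "P i (T x) = T x" if "i \<le> m" for i x
      using T(2) that proj_le_iff[OF symT P'(2)] by blast
    \<comment> \<open>This vector is fixed by \<open>P i - Q\<close> for all i \<le> m, hence by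
      \<open>R m\<close>, which is 0.\<close>
    have "T x - Q (T x) = 0" for x
    proof -
      have "R m (T x - Q (T x)) = T x - Q (T x)"
        by (rule R(3)) (simp add: blinfun.bilinear_simps PT PQ Q(4))
      then show ?thesis by (simp add: m)
    qed
    then show "proj_le T Q" by (simp add: proj_le_iff symT Q(3))
  qed
  then show "\<exists>m. Q = meet (P ` {..m})" using meet_eqI by metis
qed

end

theorem theorem5p4:
  fixes scale :: "'k::real_or_complex \<Rightarrow> 'h::banach \<Rightarrow> 'h"
    and ip :: "'h \<Rightarrow> 'h \<Rightarrow> 'k"
    and A :: "('h \<Rightarrow>\<^sub>L 'h) set"
    and P :: "nat \<Rightarrow> ('h \<Rightarrow>\<^sub>L 'h)"
  assumes "hilbert_space scale ip"
    and "hilbert_space.cstar_subalgebra scale ip A"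
    and "hilbert_space.real_rank_zero scale ip A"
    and "\<forall>n. P n \<in> hilbert_space.projections ip A"
  shows "(\<exists>Q. (\<forall>n. Q n \<in> hilbert_space.projections ip A) \<and>
            proj_decreasing Q \<and>
            hilbert_space.meet scale ip (range P) = hilbert_space.meet scale ip (range Q)) \<and>
    (sigma_closed (hilbert_space.projections ip A) \<longrightarrow>
      (\<forall>Q. is_glb_in (hilbert_space.projections ip A) (range P) Q \<longrightarrow>
        (\<exists>m. Q = hilbert_space.meet scale ip (P ` {..m}))))"
  using hilbert_space.exists_decreasing_sequence_same_meet[OF assms]
    hilbert_space.sigma_closed_glb_eq_finite_meet[OF assms] by blast

end
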